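(* Let $f:\mathbb{R}\to\mathbb{R}$ be a locally integrable function (a fixed pointwise representative of an element of $L^1_{\mathrm{loc}}(\mathbb{R})$) and let $x_0\in\mathbb{R}$. Assume that the one-sided Borel derivatives $BD_1^+f(x_0)=L_+$ and $BD_1^-f(x_0)=L_-$ both exist finitely. Then, for every $\phi\in\mathcal{D}(\mathbb{R})$, \[ \lim_{\varepsilon\to0^+}\langle T_f',\phi_{x_0,\varepsilon}\rangle = L_+\int_0^\infty \phi(u)\,du + L_-\int_{-\infty}^0 \phi(u)\,du. \] Consequently, $T_f'$ has right distributional point value $L_+$ and left distributional point value $L_-$ at $x_0$. Moreover, $T_f'$ has a Łojasiewicz distributional point value at $x_0$ if and only if $L_+=L_-$; in that case the point value equals this common value.
   Context: $\mathcal{D}(\mathbb{R})=C_c^\infty(\mathbb{R})$ and $\mathcal{D}'(\mathbb{R})$ is the space of distributions. For $f\in L^1_{\mathrm{loc}}(\mathbb{R})$, $T_f\in\mathcal{D}'(\mathbb{R})$ is the regular distribution $\langle T_f,\psi\rangle=\int_{\mathbb{R}} f\psi\,dx$, and its distributional derivative is $\langle T_f',\psi\rangle=-\langle T_f,\psi'\rangle$. For $\phi\in\mathcal{D}(\mathbb{R})$ and $\varepsilon>0$, $\phi_{x_0,\varepsilon}(x)=\varepsilon^{-1}\phi\left(\frac{x-x_0}{\varepsilon}\right)$. The right and left Borel derivatives of $f$ at $x_0$ are \[ BD_1^+f(x_0)=\lim_{h\to0^+}\frac{1}{h}\int_0^h \frac{f(x_0+t)-f(x_0)}{t}\,dt,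 \qquad BD_1^-f(x_0)=\lim_{h\to0^+}\frac{1}{h}\int_0^h \frac{f(x_0)-f(x_0-t)}{t}\,dt, \] whenever these limits exist finitely (in particular the integrands are Lebesgue integrable on $(0,h)$ for all sufficiently small $h>0$). A distribution $T$ has right (respectively left) distributional point value $L_\pm$ at $x_0$ if $\lim_{\varepsilon\to0^+}\langle T,\phi_{x_0,\varepsilon}\rangle=L_\pm\int_{\mathbb{R}}\phi(u)\,du$ for every $\phi\in\mathcal{D}(\mathbb{R})$ with $\operatorname{supp}\phi\subset[0,\infty)$ (respectively $\operatorname{supp}\phi\subset(-\infty,0]$). $T$ has the Łojasiewicz distributional point value $L\in\mathbb{R}$ at $x_0$ if $\lim_{\varepsilon\to 0^+}\langle T,\phi_{x_0,\varepsilon}\rangle=L\int_{\mathbb{R}}\phi(u)\,du$ for every $\phi\in\mathcal{D}(\mathbb{R})$. *)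

theory Defs
  imports "HOL-Analysis.Analysis"
begin

definition smooth :: "(real \<Rightarrow> real) \<Rightarrow> bool" where
  "smooth \<phi> \<longleftrightarrow> (\<forall>k. (deriv ^^ k) \<phi> differentiable_on UNIV)"

definition supp :: "(real \<Rightarrow> real) \<Rightarrow> real set" where
  "supp \<phi> = closure (support_on UNIV \<phi>)"

text \<open>The space of (real-valued) test functions.\<close>

definition test_functions :: "(real \<Rightarrow> real) set" where
  "test_functions = {\<phi>. smooth \<phi> \<and> compact (supp \<phi>)}"

text \<open>
  A distribution is represented by a functional on all functions from the reals to the reals,
  of which only the values on test functions matter: there it has to be linear and sequentially
  continuous for the usual convergence of test functions (supports in a common compact set,
  derivatives of every order converging uniformly; by linearity the limit may be taken to be 0).
\<close>

definition distribution :: "((real \<Rightarrow> real) \<Rightarrow> real) \<Rightarrow> bool" where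
  "distribution T \<longleftrightarrow>
     (\<forall>\<phi>\<in>test_functions. \<forall>\<psi>\<in>test_functions. T (\<lambda>x. \<phi> x + \<psi> x) = T \<phi> + T \<psi>) \<and>
     (\<forall>c. \<forall>\<phi>\<in>test_functions. T (\<lambda>x. c * \<phi> x) = c * T \<phi>) \<and>
     (\<forall>\<psi> :: nat \<Rightarrow> real \<Rightarrow> real. \<forall>K.
        compact K \<and> (\<forall>n. \<psi> n \<in> test_functions \<and> supp (\<psi> n) \<subseteq> K) \<and>
        (\<forall>k. uniform_limit UNIV (\<lambda>n. (deriv ^^ k) (\<psi> n)) (\<lambda>_. 0) sequentially)
        \<longrightarrow> (\<lambda>n. T (\<psi> n)) \<longlonglongrightarrow> 0)"

definition locally_integrable :: "(real \<Rightarrow> real) \<Rightarrow> bool" where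
  "locally_integrable f \<longleftrightarrow> (\<forall>K. compact K \<longrightarrow> f absolutely_integrable_on K)"

definition regular_distribution :: "(real \<Rightarrow> real) \<Rightarrow> (real \<Rightarrow> real) \<Rightarrow> real" where
  "regular_distribution f \<psi> = (LINT x|lebesgue. f x * \<psi> x)"

definition distributional_deriv ::
  "((real \<Rightarrow> real) \<Rightarrow> real) \<Rightarrow> (real \<Rightarrow> real) \<Rightarrow> real" where
  "distributional_deriv T \<psi> = - T (deriv \<psi>)"

definition rescaled :: "(real \<Rightarrow> real) \<Rightarrow> real \<Rightarrow> real \<Rightarrow> real \<Rightarrow> real" where
  "rescaled \<phi> x0 \<epsilon> x = inverse \<epsilon> * \<phi> ((x - x0) / \<epsilon>)"

definition has_right_Borel_derivative :: "(real \<Rightarrow> real) \<Rightarrow> real \<Rightarrow> real \<Rightarrow> bool" where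
  "has_right_Borel_derivative f x0 L \<longleftrightarrow>
     (\<forall>\<^sub>F h in at_right 0. (\<lambda>t. (f (x0 + t) - f x0) / t) absolutely_integrable_on {0<..<h}) \<and>
     ((\<lambda>h. 1 / h * (LINT t:{0<..<h}|lebesgue. (f (x0 + t) - f x0) / t)) \<longlongrightarrow> L) (at_right 0)"

definition has_left_Borel_derivative :: "(real \<Rightarrow> real) \<Rightarrow> real \<Rightarrow> real \<Rightarrow> bool" where
  "has_left_Borel_derivative f x0 L \<longleftrightarrow>
     (\<forall>\<^sub>F h in at_right 0. (\<lambda>t. (f x0 - f (x0 - t)) / t) absolutely_integrable_on {0<..<h}) \<and>
     ((\<lambda>h. 1 / h * (LINT t:{0<..<h}|lebesgue. (f x0 - f (x0 - t)) / t)) \<longlongrightarrow> L) (at_right 0)"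

definition has_right_point_value :: "((real \<Rightarrow> real) \<Rightarrow> real) \<Rightarrow> real \<Rightarrow> real \<Rightarrow> bool" where
  "has_right_point_value T x0 L \<longleftrightarrow> distribution T \<and>
     (\<forall>\<phi>\<in>test_functions. supp \<phi> \<subseteq> {0..} \<longrightarrow>
        ((\<lambda>\<epsilon>. T (rescaled \<phi> x0 \<epsilon>)) \<longlongrightarrow> L * (LINT u|lebesgue. \<phi> u)) (at_right 0))"

definition has_left_point_value :: "((real \<Rightarrow> real) \<Rightarrow> real) \<Rightarrow> real \<Rightarrow> real \<Rightarrow> bool" where
  "has_left_point_value T x0 L \<longleftrightarrow> distribution T \<and>
     (\<forall>\<phi>\<in>test_functions. supp \<phi> \<subseteq> {..0} \<longrightarrow>
        ((\<lambda>\<epsilon>. T (rescaled \<phi> x0 \<epsilon>)) \<longlongrightarrow> L * (LINT u|lebesgue. \<phi> u)) (at_right 0))"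

text \<open>The point value in the sense of Lojasiewicz.\<close>

definition has_point_value :: "((real \<Rightarrow> real) \<Rightarrow> real) \<Rightarrow> real \<Rightarrow> real \<Rightarrow> bool" where
  "has_point_value T x0 L \<longleftrightarrow> distribution T \<and>
     (\<forall>\<phi>\<in>test_functions.
        ((\<lambda>\<epsilon>. T (rescaled \<phi> x0 \<epsilon>)) \<longlongrightarrow> L * (LINT u|lebesgue. \<phi> u)) (at_right 0))"

end

theory Submission
  imports Defs "HOL-Computational_Algebra.Polynomial"
begin

text \<open>
  Since the derivative of a test function has integral 0, the substitution \<open>x = x0 + \<epsilon> * u\<close> turns
  the pairing with the rescaled test function into the integral over \<open>u\<close> of
  \<open>- \<phi>'(u) * (f (x0 + \<epsilon> * u) - f x0) / \<epsilon>\<close>. On the right half line this is the integral of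
  \<open>- u * \<phi>'(u) * g (\<epsilon> * u)\<close>, where \<open>g t = (f (x0 + t) - f x0) / t\<close>. No bound on the integral of
  \<open>\<bar>g\<bar>\<close> over \<open>(0, \<epsilon>)\<close> is available, only convergence of the averages of \<open>g\<close>; an integration by
  parts (an instance of Fubini's theorem) moves the derivative to \<open>u * \<phi>'(u)\<close> and expresses
  the integral through these averages. The left half line is reduced to this case by reflection,
  and two bump functions supported on either side of 0 show that a point value forces both
  one-sided limits.
\<close>

section \<open>Integration by parts on bounded open intervals\<close>

lemma set_integral_FTC:
  fixes F F' :: "real \<Rightarrow> real"
  assumes "a \<le> b" and F: "\<And>x. (F has_real_derivative F' x) (at x)" and cont: "continuous_on UNIV F'"
  shows "F' absolutely_integrable_on {a<..<b}" "(LINT x:{a<..<b}|lebesgue. F' x) = F b - F a"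
proof -
  have "F' absolutely_integrable_on {a..b}"
    by (rule absolutely_integrable_continuous_real) (rule continuous_on_subset[OF cont], simp)
  then show int: "F' absolutely_integrable_on {a<..<b}"
    by (rule set_integrable_subset) auto
  have "(F' has_integral (F b - F a)) {a..b}"
    using \<open>a \<le> b\<close> F
    by (intro fundamental_theorem_of_calculus)
      (auto simp: has_real_derivative_iff_has_vector_derivative[symmetric] intro: DERIV_subset)
  then have "integral {a<..<b} F' = F b - F a"
    by (simp add: integral_open_interval_real[symmetric] integral_unique)
  with int show "(LINT x:{a<..<b}|lebesgue. F' x) = F b - F a"
    by (simp add: set_lebesgue_integral_eq_integral)
qed

lemma absolutely_integrable_continuous_mult:
  fixes w g :: "real \<Rightarrow> real"
  assumes g: "g absolutely_integrable_on {a<..<b}" and w: "continuous_on UNIV w"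
  shows "(\<lambda>x. w x * g x) absolutely_integrable_on {a<..<b}"
proof (rule absolutely_integrable_bounded_measurable_product_real[OF _ _ _ g])
  show "w \<in> borel_measurable (lebesgue_on {a<..<b})"
    by (rule continuous_imp_measurable_on_sets_lebesgue) (use w continuous_on_subset in auto)
  have "compact (w ` {a..b})"
    by (rule compact_continuous_image) (use w continuous_on_subset in auto)
  then show "bounded (w ` {a<..<b})"
    by (rule bounded_subset[OF compact_imp_bounded]) auto
qed auto

text \<open>Because \<open>k R = 0\<close>, the value \<open>k u\<close> is minus the integral of
  \<open>w\<close> over (u, R). Inserting this and exchanging the order of integration over the
  triangle 0 < u < s < R gives the identity, with \<open>g\<close> merely integrable. For R \<le> 0
  both sides are integrals over the empty set.\<close>

lemma set_integral_by_parts: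
  fixes g k w :: "real \<Rightarrow> real"
  assumes g: "g absolutely_integrable_on {0<..<R}"
    and k: "\<And>x. (k has_real_derivative w x) (at x)" and w: "continuous_on UNIV w" and "k R = 0"
  shows "(LINT u:{0<..<R}|lebesgue. k u * g u) =
         - (LINT s:{0<..<R}|lebesgue. w s * (LINT u:{0<..<s}|lebesgue. g u))"
proof -
  let ?g = "\<lambda>u. indicator {0<..<R} u * g u"
  let ?w = "\<lambda>s. indicator {0<..<R} s * w s"
  have gi: "integrable lebesgue ?g"
    using g by (simp add: set_integrable_def)
  \<comment> \<open>Fubini's theorem is applied to the product of two copies of
    \<open>lborel\<close>. There the Lebesgue measurable \<open>?g\<close> has to be replaced by a
    Borel function \<open>g'\<close> that agrees with it almost everywhere.\<close>
  then obtain g' where g'[measurable]: "g' \<in> borel_measurable lborel" and ae: "AE x in lborel. ?g x = g' x"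
    using completion_ex_borel_measurable_real[OF borel_measurable_integrable] by blast
  have ae': "AE x in lebesgue. ?g x = g' x"
    using ae by (rule AE_completion)
  have g'i: "integrable lborel g'"
    using gi ae' integrable_cong_AE_imp[of lebesgue ?g g'] g' integrable_completion[of g' lborel]
    by (metis (no_types, lifting) AE_mp AE_I2 measurable_completion)
  have [measurable]: "w \<in> borel_measurable borel"
    using w by (simp add: borel_measurable_continuous_onI)
  have [measurable]: "k \<in> borel_measurable borel"
    using k by (intro borel_measurable_continuous_onI) (meson DERIV_continuous_on UNIV_I DERIV_subset subset_UNIV)
  have "integrable lebesgue ?w"
  proof (cases "0 \<le> R")
    case True
    then show ?thesis
      using set_integral_FTC(1)[OF _ k w, of 0 R] by (simp add: set_integrable_def)
  qed simp
  then have wi: "integrable lborel ?w"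
    by (simp add: integrable_completion)
  have prod: "integrable (lborel \<Otimes>\<^sub>M lborel) (\<lambda>(u, s). g' u * ?w s)"
  proof (rule lborel_pair.Fubini_integrable)
    show "integrable lborel (\<lambda>x. LINT y|lborel. norm (case (x, y) of (u, s) \<Rightarrow> g' u * ?w s))"
      using g'i by (simp add: abs_mult)
    show "AE x in lborel. integrable lborel (\<lambda>y. case (x, y) of (u, s) \<Rightarrow> g' u * ?w s)"
      using wi by simp
  qed simp
  \<comment> \<open>Restricting to the triangle u < s keeps integrability, by domination by the full
    product.\<close>
  have prod': "integrable (lborel \<Otimes>\<^sub>M lborel) (\<lambda>(u, s). g' u * ?w s * of_bool (u < s))"
    by (rule Bochner_Integration.integrable_bound[OF prod]) (auto simp: abs_mult)
  have "(LINT s|lborel. LINT u|lborel. g' u * ?w s * of_bool (u < s)) =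
    (LINT u|lborel. LINT s|lborel. g' u * ?w s * of_bool (u < s))"
    by (rule lborel_pair.Fubini_integral[OF prod'])
  also have "\<dots> = (LINT u|lborel. - (k u * g' u))"
  proof (rule integral_cong_AE)
    \<comment> \<open>Inside (0, R) the inner integral is \<open>k R - k u\<close>. Outside, both
      sides vanish for almost every u, since \<open>g'\<close> agrees with \<open>?g\<close>
      there.\<close>
    show "AE u in lborel. (LINT s|lborel. g' u * ?w s * of_bool (u < s)) = - (k u * g' u)"
      using ae
    proof (eventually_elim)
      case (elim u)
      show ?case
      proof (cases "u \<in> {0<..<R}")
        case True
        have "(LINT s|lborel. g' u * ?w s * of_bool (u < s)) = g' u * (LINT s|lborel. ?w s * of_bool (u < s))"
          by (simp add: mult.assoc)
        also have "(LINT s|lborel. ?w s * of_bool (u < s)) = (LINT s:{u<..<R}|lborel. w s)"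
          unfolding set_lebesgue_integral_def
          by (rule Bochner_Integration.integral_cong) (use True in \<open>auto simp: indicator_def\<close>)
        also have "\<dots> = (LINT s:{u<..<R}|lebesgue. w s)"
          by (simp add: set_lebesgue_integral_def integral_completion)
        also have "\<dots> = - k u"
          using set_integral_FTC(2)[OF _ k w, of u R] True \<open>k R = 0\<close> by simp
        finally show ?thesis
          by simp
      qed (use elim in simp)
    qed
  qed simp_all
  also have "\<dots> = - (LINT u|lebesgue. k u * g' u)"
    by (simp add: integral_completion)
  also have "(LINT u|lebesgue. k u * g' u) = (LINT u:{0<..<R}|lebesgue. k u * g u)"
    unfolding set_lebesgue_integral_def
  proof (rule integral_cong_AE)
    show "AE u in lebesgue. k u * g' u = indicator {0<..<R} u *\<^sub>R (k u * g u)"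
      using ae' by eventually_elim (simp add: algebra_simps)
    have "(\<lambda>u. k u * ?g u) \<in> borel_measurable lebesgue"
      by (rule borel_measurable_times[OF _ borel_measurable_integrable[OF gi]]) (intro measurable_completion; simp)
    then show "(\<lambda>u. indicator {0<..<R} u *\<^sub>R (k u * g u)) \<in> borel_measurable lebesgue"
      by (simp add: algebra_simps)
  qed (intro measurable_completion; simp)
  also have "(LINT s|lborel. LINT u|lborel. g' u * ?w s * of_bool (u < s)) =
      (LINT s|lebesgue. LINT u|lborel. g' u * ?w s * of_bool (u < s))"
    by (simp add: integral_completion)
  also have "\<dots> = (LINT s:{0<..<R}|lebesgue. w s * (LINT u:{0<..<s}|lebesgue. g u))"
    unfolding set_lebesgue_integral_def[of _ "{0<..<R}"]
  proof (rule Bochner_Integration.integral_cong[OF refl])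
    fix s
    show "(LINT u|lborel. g' u * ?w s * of_bool (u < s)) =
      indicator {0<..<R} s *\<^sub>R (w s * (LINT u:{0<..<s}|lebesgue. g u))"
    proof (cases "s \<in> {0<..<R}")
      case True
      have "(LINT u|lborel. g' u * ?w s * of_bool (u < s)) = (LINT u|lborel. w s * (g' u * of_bool (u < s)))"
        by (rule Bochner_Integration.integral_cong) (use True in auto)
      also have "\<dots> = w s * (LINT u|lborel. g' u * of_bool (u < s))"
        by simp
      also have "(LINT u|lborel. g' u * of_bool (u < s)) = (LINT u|lebesgue. g' u * of_bool (u < s))"
        by (simp add: integral_completion)
      also have "\<dots> = (LINT u:{0<..<s}|lebesgue. g u)"
        unfolding set_lebesgue_integral_def
      proof (rule integral_cong_AE)
        \<comment> \<open>The lower limit 0 is hidden in \<open>g'\<close>, which vanishes almost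
          everywhere outside (0, R); the upper limit comes from u < s < R.\<close>
        show "AE u in lebesgue. g' u * of_bool (u < s) = indicator {0<..<s} u *\<^sub>R g u"
          using ae' by eventually_elim (use True in \<open>auto simp: indicator_def split: if_splits\<close>)
        have "g absolutely_integrable_on {0<..<s}"
          by (rule set_integrable_subset[OF g]) (use True in auto)
        then show "(\<lambda>u. indicator {0<..<s} u *\<^sub>R g u) \<in> borel_measurable lebesgue"
          unfolding set_integrable_def by (rule borel_measurable_integrable)
      qed (intro measurable_completion; simp)
      finally show ?thesis
        using True by simp
    qed simp
  qed
  finally show ?thesis
    by simp
qed


section \<open>From convergence of averages to integrals against a fixed weight\<close>

text \<open>Lets the integral of \<open>g (\<epsilon> * u)\<close> over (0, s) be read as s times
  the average of \<open>g\<close> over (0, \<epsilon> s).\<close>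

lemma set_integral_rescale:
  fixes g :: "real \<Rightarrow> real"
  assumes "\<epsilon> > 0"
  shows "(LINT u:{0<..<s}|lebesgue. g (\<epsilon> * u)) = (LINT t:{0<..<\<epsilon> * s}|lebesgue. g t) / \<epsilon>"
    and "g absolutely_integrable_on {0<..<\<epsilon> * s} \<Longrightarrow> (\<lambda>u. g (\<epsilon> * u)) absolutely_integrable_on {0<..<s}"
proof -
  have ind: "indicator {0<..<\<epsilon> * s} (\<epsilon> * u) = (indicator {0<..<s} u :: real)" for u
    using assms by (auto simp: indicator_def zero_less_mult_iff)
  show "(LINT u:{0<..<s}|lebesgue. g (\<epsilon> * u)) = (LINT t:{0<..<\<epsilon> * s}|lebesgue. g t) / \<epsilon>"
    using lebesgue_integral_real_affine[of \<epsilon> "\<lambda>t. indicator {0<..<\<epsilon> * s} t *\<^sub>R g t" 0] assms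
    by (simp add: set_lebesgue_integral_def ind)
  show "(\<lambda>u. g (\<epsilon> * u)) absolutely_integrable_on {0<..<s}" if "g absolutely_integrable_on {0<..<\<epsilon> * s}"
    using lebesgue_integrable_real_affine_iff[of \<epsilon> "\<lambda>t. indicator {0<..<\<epsilon> * s} t *\<^sub>R g t" 0] assms that
    by (simp add: set_integrable_def ind)
qed

text \<open>Integration by parts is applied to \<open>g (\<epsilon> * u) - L\<close>. Its integral
  over (0, s) is s times the deviation from \<open>L\<close> of the average of \<open>g\<close> over
  (0, \<epsilon> s), which is small uniformly in s < R. Integrating this against the fixed function
  \<open>w\<close> keeps it small.\<close>

lemma tendsto_integral_of_average:
  fixes g k w :: "real \<Rightarrow> real"
  assumes int: "\<forall>\<^sub>F h in at_right 0. g absolutely_integrable_on {0<..<h}"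
    and lim: "((\<lambda>h. 1 / h * (LINT t:{0<..<h}|lebesgue. g t)) \<longlongrightarrow> L) (at_right 0)"
    and k: "\<And>x. (k has_real_derivative w x) (at x)" and w: "continuous_on UNIV w"
    and "k R = 0" "0 < R"
  shows "((\<lambda>\<epsilon>. LINT u:{0<..<R}|lebesgue. k u * g (\<epsilon> * u)) \<longlongrightarrow> L * (LINT u:{0<..<R}|lebesgue. k u)) (at_right 0)"
proof (rule tendstoI)
  fix e :: real assume "e > 0"
  define W where "W = (LINT s:{0<..<R}|lebesgue. \<bar>w s\<bar>)"
  have wint: "w absolutely_integrable_on {0<..<R}"
    using set_integral_FTC(1)[OF _ k w, of 0 R] \<open>0 < R\<close> by simp
  have "W \<ge> 0"
    unfolding W_def set_lebesgue_integral_def by (rule integral_nonneg_AE) auto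
  \<comment> \<open>The final estimate is \<open>W * (\<eta> * R)\<close>, and \<eta> makes
    \<open>(W + 1) * (\<eta> * R)\<close> equal to e. The summand 1 covers the case W = 0.\<close>
  define \<eta> where "\<eta> = e / (R * (W + 1))"
  have "\<eta> > 0"
    using \<open>e > 0\<close> \<open>0 < R\<close> \<open>W \<ge> 0\<close> by (simp add: \<eta>_def)
  have "\<forall>\<^sub>F h in at_right 0. g absolutely_integrable_on {0<..<h} \<and>
      \<bar>1 / h * (LINT t:{0<..<h}|lebesgue. g t) - L\<bar> < \<eta>"
    using int tendstoD[OF lim \<open>\<eta> > 0\<close>] by eventually_elim (simp add: dist_real_def)
  then obtain d where "d > 0" and d: "\<And>h. 0 < h \<Longrightarrow> h < d \<Longrightarrow> g absolutely_integrable_on {0<..<h} \<and>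
      \<bar>1 / h * (LINT t:{0<..<h}|lebesgue. g t) - L\<bar> < \<eta>"
    by (auto simp: eventually_at_right_field)
  \<comment> \<open>The condition \<epsilon> < d / R puts \<epsilon> s below d for all s \<le> R at
    once, so one choice of d controls every average that occurs.\<close>
  have main: "dist (LINT u:{0<..<R}|lebesgue. k u * g (\<epsilon> * u)) (L * (LINT u:{0<..<R}|lebesgue. k u)) < e"
    if "0 < \<epsilon>" "\<epsilon> < d / R" for \<epsilon>
  proof -
    have "\<epsilon> * R < d"
      using that \<open>0 < R\<close> by (simp add: field_simps)
    have gint: "(\<lambda>u. g (\<epsilon> * u)) absolutely_integrable_on {0<..<s}" if "0 < s" "s \<le> R" for s
    proof (rule set_integral_rescale(2)[OF \<open>0 < \<epsilon>\<close>])
      have "\<epsilon> * s \<le> \<epsilon> * R" "0 < \<epsilon> * s"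
        using that \<open>0 < \<epsilon>\<close> by auto
      then show "g absolutely_integrable_on {0<..<\<epsilon> * s}"
        using d \<open>\<epsilon> * R < d\<close> by fastforce
    qed
    have const: "(\<lambda>u. c) absolutely_integrable_on {0<..<s}" for c s :: real
      by (simp add: absolutely_integrable_on_const)
    have kcont: "continuous_on UNIV k"
      using k DERIV_continuous_on by blast
    let ?H = "\<lambda>s. LINT u:{0<..<s}|lebesgue. g (\<epsilon> * u) - L"
    have H: "\<bar>?H s\<bar> \<le> \<eta> * R" if "0 < s" "s < R" for s
    proof -
      have "\<epsilon> * s \<le> \<epsilon> * R" "0 < \<epsilon> * s"
        using that \<open>0 < \<epsilon>\<close> by auto
      then have *: "\<bar>1 / (\<epsilon> * s) * (LINT t:{0<..<\<epsilon> * s}|lebesgue. g t) - L\<bar> < \<eta>"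
        using d \<open>\<epsilon> * R < d\<close> by fastforce
      have "?H s = (LINT u:{0<..<s}|lebesgue. g (\<epsilon> * u)) - (LINT u:{0<..<s}|lebesgue. L)"
        by (rule set_integral_diff) (use gint const that in auto)
      also have "(LINT u:{0<..<s}|lebesgue. L) = s * L"
        using that by (simp add: set_lebesgue_integral_def)
      also have "(LINT u:{0<..<s}|lebesgue. g (\<epsilon> * u)) - s * L =
          s * (1 / (\<epsilon> * s) * (LINT t:{0<..<\<epsilon> * s}|lebesgue. g t) - L)"
        using that \<open>0 < \<epsilon>\<close> by (simp add: set_integral_rescale(1) right_diff_distrib)
      finally have "\<bar>?H s\<bar> = s * \<bar>1 / (\<epsilon> * s) * (LINT t:{0<..<\<epsilon> * s}|lebesgue. g t) - L\<bar>"
        using that by (simp add: abs_mult)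
      also have "\<dots> \<le> R * \<eta>"
        by (rule mult_mono) (use that * in auto)
      finally show ?thesis by (simp add: mult.commute)
    qed
    have kg: "(\<lambda>u. k u * g (\<epsilon> * u)) absolutely_integrable_on {0<..<R}"
      "(\<lambda>u. k u * L) absolutely_integrable_on {0<..<R}"
      using gint[of R] const \<open>0 < R\<close> kcont by (auto intro!: absolutely_integrable_continuous_mult)
    have gL: "(\<lambda>u. g (\<epsilon> * u) - L) absolutely_integrable_on {0<..<R}"
      using gint[of R] const \<open>0 < R\<close> by (intro set_integral_diff) auto
    have "(LINT u:{0<..<R}|lebesgue. k u * g (\<epsilon> * u)) - L * (LINT u:{0<..<R}|lebesgue. k u) =
       (LINT u:{0<..<R}|lebesgue. k u * (g (\<epsilon> * u) - L))"
      using set_integral_diff(2)[OF kg] by (simp add: algebra_simps)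
    also have "\<dots> = - (LINT s:{0<..<R}|lebesgue. w s * ?H s)"
      by (rule set_integral_by_parts[OF gL k w \<open>k R = 0\<close>])
    finally have eq: "(LINT u:{0<..<R}|lebesgue. k u * g (\<epsilon> * u)) - L * (LINT u:{0<..<R}|lebesgue. k u) =
      - (LINT s:{0<..<R}|lebesgue. w s * ?H s)" .
    have "\<bar>LINT s:{0<..<R}|lebesgue. w s * ?H s\<bar> \<le> (LINT s:{0<..<R}|lebesgue. \<bar>w s\<bar> * (\<eta> * R))"
    \<comment> \<open>If the product is not integrable, its Bochner integral is 0 by convention, and
      the bound holds because the right side is nonnegative.\<close>
    proof (cases "(\<lambda>s. w s * ?H s) absolutely_integrable_on {0<..<R}")
      case True
      have "\<bar>LINT s:{0<..<R}|lebesgue. w s * ?H s\<bar> \<le> (LINT s:{0<..<R}|lebesgue. \<bar>w s * ?H s\<bar>)"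
        using set_integral_norm_bound[OF True] by simp
      also have "\<dots> \<le> (LINT s:{0<..<R}|lebesgue. \<bar>w s\<bar> * (\<eta> * R))"
      proof (rule set_integral_mono)
        show "(\<lambda>s. \<bar>w s * ?H s\<bar>) absolutely_integrable_on {0<..<R}"
          using True by (rule set_integrable_abs)
      qed (use wint H in \<open>auto simp: abs_mult intro!: mult_left_mono set_integrable_abs\<close>)
      finally show ?thesis .
    next
      case False
      then show ?thesis
        using \<open>W \<ge> 0\<close> \<open>\<eta> > 0\<close> \<open>0 < R\<close> W_def by (simp add: set_lebesgue_integral_def set_integrable_def not_integrable_integral_eq)
    qed
    also have "\<dots> = W * (\<eta> * R)"
      by (simp add: W_def)
    also have "\<dots> < (W + 1) * (\<eta> * R)"
      using \<open>\<eta> > 0\<close> \<open>0 < R\<close> by simp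
    also have "\<dots> = e"
      using \<open>0 < R\<close> \<open>W \<ge> 0\<close> by (simp add: \<eta>_def)
    finally show ?thesis
      using eq by (simp add: dist_real_def)
  qed
  have "\<forall>\<^sub>F \<epsilon> in at_right 0. \<epsilon> < d / R"
    by (rule order_tendstoD(2)[OF tendsto_ident_at]) (use \<open>d > 0\<close> \<open>0 < R\<close> in simp)
  with eventually_at_right_less[of 0]
  show "\<forall>\<^sub>F \<epsilon> in at_right 0. dist (LINT u:{0<..<R}|lebesgue. k u * g (\<epsilon> * u)) (L * (LINT u:{0<..<R}|lebesgue. k u)) < e"
    by eventually_elim (rule main)
qed

text \<open>The weight is k u = u \<psi>'(u), which vanishes at R along with \<psi>'. Its integral
  is minus that of \<psi>, since \<psi> + u \<psi>' is the derivative of u \<psi>(u); the boundary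
  term at R vanishes through \<psi>, the one at 0 through the factor u.\<close>

lemma tendsto_integral_against_derivative:
  fixes g \<psi> \<psi>' \<psi>'' :: "real \<Rightarrow> real"
  assumes int: "\<forall>\<^sub>F h in at_right 0. g absolutely_integrable_on {0<..<h}"
    and lim: "((\<lambda>h. 1 / h * (LINT t:{0<..<h}|lebesgue. g t)) \<longlongrightarrow> L) (at_right 0)"
    and \<psi>: "\<And>x. (\<psi> has_real_derivative \<psi>' x) (at x)" "\<And>x. (\<psi>' has_real_derivative \<psi>'' x) (at x)"
      "continuous_on UNIV \<psi>''"
    and "0 < R" "\<psi> R = 0" "\<psi>' R = 0"
  shows "((\<lambda>\<epsilon>. LINT u:{0<..<R}|lebesgue. (u * \<psi>' u) * g (\<epsilon> * u)) \<longlongrightarrow>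
    - (L * (LINT u:{0<..<R}|lebesgue. \<psi> u))) (at_right 0)"
proof -
  have cont: "continuous_on UNIV \<psi>" "continuous_on UNIV \<psi>'"
    using \<psi> DERIV_continuous_on by blast+
  have der: "((\<lambda>u. u * \<psi>' u) has_real_derivative \<psi>' u + u * \<psi>'' u) (at u)"
    "((\<lambda>u. u * \<psi> u) has_real_derivative \<psi> u + u * \<psi>' u) (at u)" for u
    by (rule derivative_eq_intros \<psi> refl | simp)+
  have ints: "\<psi> absolutely_integrable_on {0<..<R}" "(\<lambda>u. u * \<psi>' u) absolutely_integrable_on {0<..<R}"
    using cont by (auto intro!: set_integrable_subset[OF absolutely_integrable_continuous_real[of 0 R]]
        continuous_intros intro: continuous_on_subset)
  have "(LINT u:{0<..<R}|lebesgue. \<psi> u + u * \<psi>' u) = 0"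
    using set_integral_FTC(2)[OF _ der(2), of 0 R] \<open>0 < R\<close> \<open>\<psi> R = 0\<close> cont
    by (simp add: continuous_intros)
  then have "(LINT u:{0<..<R}|lebesgue. u * \<psi>' u) = - (LINT u:{0<..<R}|lebesgue. \<psi> u)"
    using set_integral_add(2)[OF ints] by simp
  moreover have "continuous_on UNIV (\<lambda>u. \<psi>' u + u * \<psi>'' u)"
    using cont \<psi>(3) by (intro continuous_intros)
  ultimately show ?thesis
    using tendsto_integral_of_average[OF int lim der(1), of R] assms by simp
qed

section \<open>Splitting integrals at 0\<close>

text \<open>The two half lines cover everything but the null set {0}, and u \<mapsto> -u carries the
  left one to the right one. Both contributions thus become integrals over (0, R), where the
  one-sided limit result applies.\<close>

lemma integral_eq_half_lines:
  fixes h :: "real \<Rightarrow> real"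
  assumes h: "integrable lebesgue h" and zero: "\<And>u. R \<le> \<bar>u\<bar> \<Longrightarrow> h u = 0"
  shows "(LINT u|lebesgue. h u) = (LINT u:{0<..<R}|lebesgue. h u) + (LINT u:{0<..<R}|lebesgue. h (- u))"
    and "(LINT u:{0<..}|lebesgue. h u) = (LINT u:{0<..<R}|lebesgue. h u)"
    and "(LINT u:{..<0}|lebesgue. h u) = (LINT u:{0<..<R}|lebesgue. h (- u))"
proof -
  have int: "h absolutely_integrable_on S" if "S \<in> sets lebesgue" for S
    using integrable_mult_indicator[OF that h] by (simp add: set_integrable_def)
  show pos: "(LINT u:{0<..}|lebesgue. h u) = (LINT u:{0<..<R}|lebesgue. h u)"
    unfolding set_lebesgue_integral_def
    by (rule Bochner_Integration.integral_cong) (use zero in \<open>auto simp: indicator_def\<close>)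
  have "(LINT u:{..<0}|lebesgue. h u) = (LINT u|lebesgue. indicator {..<0} (- u) *\<^sub>R h (- u))"
    using lebesgue_integral_real_affine[of "-1" "\<lambda>u. indicator {..<0} u *\<^sub>R h u" 0]
    by (simp add: set_lebesgue_integral_def)
  also have "\<dots> = (LINT u:{0<..<R}|lebesgue. h (- u))"
    unfolding set_lebesgue_integral_def
    by (rule Bochner_Integration.integral_cong) (use zero in \<open>auto simp: indicator_def\<close>)
  finally show neg: "(LINT u:{..<0}|lebesgue. h u) = (LINT u:{0<..<R}|lebesgue. h (- u))" .
  have "AE u in lebesgue. u \<noteq> (0::real)"
    using AE_lborel_singleton by (rule AE_completion)
  then have "AE u in lebesgue. h u = indicator ({0<..} \<union> {..<0}) u *\<^sub>R h u"
    by eventually_elim (auto simp: indicator_def)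
  then have "(LINT u|lebesgue. h u) = (LINT u:{0<..} \<union> {..<0}|lebesgue. h u)"
    unfolding set_lebesgue_integral_def
    by (rule integral_cong_AE[rotated 2])
      (use h int[of "{0<..} \<union> {..<0}"] in \<open>auto simp: set_integrable_def borel_measurable_integrable\<close>)
  also have "\<dots> = (LINT u:{0<..}|lebesgue. h u) + (LINT u:{..<0}|lebesgue. h u)"
    by (rule set_integral_Un) (auto intro: int)
  finally show "(LINT u|lebesgue. h u) = (LINT u:{0<..<R}|lebesgue. h u) + (LINT u:{0<..<R}|lebesgue. h (- u))"
    by (simp add: pos neg)
qed

section \<open>Test functions and the distributional derivative of a regular distribution\<close>

lemma zero_outside_supp: "x \<notin> supp \<phi> \<Longrightarrow> \<phi> x = 0"
  using closure_subset[of "support_on UNIV \<phi>"] by (auto simp: supp_def support_on_def)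

lemma test_function_has_derivative:
  assumes "\<phi> \<in> test_functions"
  shows "(\<phi> has_real_derivative deriv \<phi> x) (at x)"
proof -
  have "(deriv ^^ 0) \<phi> differentiable_on UNIV"
    using assms unfolding test_functions_def smooth_def by blast
  then show ?thesis
    by (simp add: DERIV_deriv_iff_real_differentiable differentiable_on_def)
qed

text \<open>The complement of \<open>supp \<phi>\<close> is open and \<phi> is zero on it, so its
  derivative is zero there as well. Compactness passes to the smaller closed support.\<close>

lemma deriv_test_function:
  assumes "\<phi> \<in> test_functions"
  shows "deriv \<phi> \<in> test_functions" "supp (deriv \<phi>) \<subseteq> supp \<phi>"
proof -
  have "deriv \<phi> x = 0" if "x \<notin> supp \<phi>" for x
  proof (rule DERIV_imp_deriv, rule has_field_derivative_transform_within_open[of "\<lambda>_. 0"])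
    show "open (- supp \<phi>)"
      by (simp add: supp_def open_Compl)
  qed (use that zero_outside_supp in auto)
  then show *: "supp (deriv \<phi>) \<subseteq> supp \<phi>"
    unfolding supp_def[of "deriv \<phi>"]
    by (intro closure_minimal) (auto simp: support_on_def supp_def)
  have "(deriv ^^ k) (deriv \<phi>) differentiable_on UNIV" for k
    using assms unfolding test_functions_def smooth_def by (metis (mono_tags) comp_apply funpow_Suc_right mem_Collect_eq)
  moreover have "compact (supp (deriv \<phi>))"
    using * assms unfolding test_functions_def supp_def
    by (metis (mono_tags, lifting) bounded_subset closed_closure compact_eq_bounded_closed mem_Collect_eq)
  ultimately show "deriv \<phi> \<in> test_functions"
    by (simp add: test_functions_def smooth_def)
qed

lemma test_function_continuous: "\<phi> \<in> test_functions \<Longrightarrow> continuous_on S \<phi>"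
  using test_function_has_derivative DERIV_continuous_on continuous_on_subset[of UNIV \<phi> S] by blast

text \<open>R lies strictly beyond the support, so \<phi> and its derivative vanish at \<plusminus>R
  too; these are the boundary conditions for integration by parts.\<close>

lemma test_function_bounded_support:
  assumes "\<phi> \<in> test_functions"
  obtains R where "R > 0" "\<And>x. R \<le> \<bar>x\<bar> \<Longrightarrow> \<phi> x = 0 \<and> deriv \<phi> x = 0"
proof -
  have "bounded (supp \<phi>)"
    using assms by (auto simp: test_functions_def compact_imp_bounded)
  then obtain R where "R > 0" "\<And>x. x \<in> supp \<phi> \<Longrightarrow> \<bar>x\<bar> < R"
    unfolding bounded_pos_less by auto
  then show thesis
    using that zero_outside_supp deriv_test_function(2)[OF assms] by (metis not_le subset_iff)
qed

text \<open>On the compact set K the continuous \<open>w\<close> is bounded, and off K the product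
  is zero.\<close>

lemma integrable_mult_continuous:
  fixes f w :: "real \<Rightarrow> real"
  assumes "f absolutely_integrable_on K" "compact K" "continuous_on K w" "\<And>x. x \<notin> K \<Longrightarrow> w x = 0"
  shows "integrable lebesgue (\<lambda>x. f x * w x)"
proof -
  have "K \<in> sets lebesgue"
    using \<open>compact K\<close> by (simp add: borel_compact)
  then have "(\<lambda>x. w x * f x) absolutely_integrable_on K"
    using assms
    by (intro absolutely_integrable_bounded_measurable_product_real)
      (auto intro: continuous_imp_measurable_on_sets_lebesgue compact_imp_bounded compact_continuous_image)
  moreover have "indicator K x *\<^sub>R (w x * f x) = f x * w x" for x
    using assms(4)[of x] by (auto simp: indicator_def)
  ultimately show ?thesis
    by (simp only: set_integrable_def)
qed

lemma integrable_mult_test_function: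
  assumes "locally_integrable f" "\<phi> \<in> test_functions"
  shows "integrable lebesgue (\<lambda>x. f x * \<phi> x)"
  by (rule integrable_mult_continuous[where K = "supp \<phi>"])
    (use assms zero_outside_supp test_function_continuous in \<open>auto simp: test_functions_def locally_integrable_def\<close>)

lemma integrable_test_function:
  assumes "\<phi> \<in> test_functions"
  shows "integrable lebesgue \<phi>"
proof -
  have "locally_integrable (\<lambda>_. 1)"
    by (auto simp: locally_integrable_def intro!: absolutely_integrable_on_const lmeasurable_compact)
  from integrable_mult_test_function[OF this assms] show ?thesis
    by simp
qed

text \<open>Each notion of point value includes being a distribution. Continuity follows from
  bounding the pairing by the supremum of \<bar>\<psi>'\<bar> times the integral of \<bar>f\<bar>
  over the common compact set K.\<close>

lemma distribution_distributional_deriv_regular: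
  assumes f: "locally_integrable f"
  shows "distribution (distributional_deriv (regular_distribution f))"
  unfolding distribution_def distributional_deriv_def regular_distribution_def
proof (intro conjI ballI allI impI)
  note int = integrable_mult_test_function[OF f deriv_test_function(1)]
  fix \<phi> assume \<phi>: "\<phi> \<in> test_functions"
  show "- (LINT x|lebesgue. f x * deriv (\<lambda>x. c * \<phi> x) x) = c * - (LINT x|lebesgue. f x * deriv \<phi> x)" for c
  proof -
    have "deriv (\<lambda>x. c * \<phi> x) x = c * deriv \<phi> x" for x
      by (intro DERIV_imp_deriv DERIV_cmult test_function_has_derivative \<phi>)
    then show ?thesis
      by (simp add: mult.left_commute)
  qed
  fix \<psi> assume \<psi>: "\<psi> \<in> test_functions"
  have "deriv (\<lambda>x. \<phi> x + \<psi> x) x = deriv \<phi> x + deriv \<psi> x" for x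
    by (intro DERIV_imp_deriv DERIV_add test_function_has_derivative \<phi> \<psi>)
  then show "- (LINT x|lebesgue. f x * deriv (\<lambda>x. \<phi> x + \<psi> x) x) =
      - (LINT x|lebesgue. f x * deriv \<phi> x) + - (LINT x|lebesgue. f x * deriv \<psi> x)"
    using int[OF \<phi>] int[OF \<psi>] by (simp add: distrib_left)
next
  fix \<psi> :: "nat \<Rightarrow> real \<Rightarrow> real" and K
  assume asm: "compact K \<and> (\<forall>n. \<psi> n \<in> test_functions \<and> supp (\<psi> n) \<subseteq> K) \<and>
    (\<forall>k. uniform_limit UNIV (\<lambda>n. (deriv ^^ k) (\<psi> n)) (\<lambda>_. 0) sequentially)"
  have fK: "f absolutely_integrable_on K"
    using f asm by (simp add: locally_integrable_def)
  define C where "C = (LINT x:K|lebesgue. \<bar>f x\<bar>)"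
  have "C \<ge> 0"
    unfolding C_def set_lebesgue_integral_def by (rule integral_nonneg_AE) auto
  \<comment> \<open>Order k = 1 of the assumed convergence: the first derivatives tend to 0
    uniformly.\<close>
  have unif: "uniform_limit UNIV (\<lambda>n. deriv (\<psi> n)) (\<lambda>_. 0) sequentially"
    using asm[THEN conjunct2, THEN conjunct2, rule_format, of 1] by simp
  have bound: "\<bar>LINT x|lebesgue. f x * deriv (\<psi> n) x\<bar> \<le> e * C"
    if "\<And>x. \<bar>deriv (\<psi> n) x\<bar> \<le> e" for n e
  proof -
    have \<psi>n: "\<psi> n \<in> test_functions" "supp (deriv (\<psi> n)) \<subseteq> K"
      using asm deriv_test_function(2)[of "\<psi> n"] by auto
    have le: "\<bar>f x * deriv (\<psi> n) x\<bar> \<le> e * (indicator K x *\<^sub>R \<bar>f x\<bar>)" for x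
    proof (cases "x \<in> K")
      case True
      then show ?thesis
        using mult_left_mono[OF that[of x], of "\<bar>f x\<bar>"] by (simp add: abs_mult mult.commute)
    next
      case False
      then have "deriv (\<psi> n) x = 0"
        using \<psi>n(2) zero_outside_supp by blast
      then show ?thesis
        using False by simp
    qed
    have "norm (LINT x|lebesgue. f x * deriv (\<psi> n) x) \<le> (LINT x|lebesgue. e * (indicator K x *\<^sub>R \<bar>f x\<bar>))"
    proof (rule Bochner_Integration.integral_norm_bound_integral)
      show "integrable lebesgue (\<lambda>x. e * (indicator K x *\<^sub>R \<bar>f x\<bar>))"
        using set_integrable_abs[OF fK] unfolding set_integrable_def by (rule integrable_mult_right)
    qed (use le integrable_mult_test_function[OF f deriv_test_function(1)] \<psi>n in auto)
    then show ?thesis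
      by (simp add: C_def set_lebesgue_integral_def)
  qed
  show "(\<lambda>n. - (LINT x|lebesgue. f x * deriv (\<psi> n) x)) \<longlonglongrightarrow> 0"
  proof (rule tendstoI)
    fix e :: real assume "e > 0"
    define d where "d = e / (C + 1)"
    have "d > 0"
      using \<open>e > 0\<close> \<open>C \<ge> 0\<close> by (simp add: d_def)
    have "d * C < e"
      using \<open>e > 0\<close> \<open>C \<ge> 0\<close> by (simp add: d_def field_simps)
    have "\<forall>\<^sub>F n in sequentially. \<forall>x\<in>UNIV. dist (deriv (\<psi> n) x) 0 < d"
      using uniform_limitD[OF unif \<open>d > 0\<close>] .
    then show "\<forall>\<^sub>F n in sequentially. dist (- (LINT x|lebesgue. f x * deriv (\<psi> n) x)) 0 < e"
    proof eventually_elim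
      case (elim n)
      then have "\<bar>LINT x|lebesgue. f x * deriv (\<psi> n) x\<bar> \<le> d * C"
        by (intro bound) (auto intro: less_imp_le)
      then show ?case
        using \<open>d * C < e\<close> by simp
    qed
  qed
qed

section \<open>The pairing with rescaled test functions and its limit\<close>

lemma distributional_deriv_rescaled:
  assumes f: "locally_integrable f" and \<phi>: "\<phi> \<in> test_functions" and "\<epsilon> > 0"
  shows "integrable lebesgue (\<lambda>u. (f (x0 + \<epsilon> * u) - f x0) / \<epsilon> * deriv \<phi> u)"
    "distributional_deriv (regular_distribution f) (rescaled \<phi> x0 \<epsilon>) =
       - (LINT u|lebesgue. (f (x0 + \<epsilon> * u) - f x0) / \<epsilon> * deriv \<phi> u)"
proof -
  note \<phi>' = deriv_test_function(1)[OF \<phi>]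
  have der: "deriv (rescaled \<phi> x0 \<epsilon>) x = deriv \<phi> ((x - x0) / \<epsilon>) / \<epsilon>\<^sup>2" for x
    unfolding rescaled_def
    by (rule DERIV_imp_deriv derivative_eq_intros test_function_has_derivative[OF \<phi>, THEN DERIV_chain2] refl
        | use \<open>\<epsilon> > 0\<close> in \<open>simp add: field_simps power2_eq_square\<close>)+
  obtain R where "R > 0" and R: "\<And>x. R \<le> \<bar>x\<bar> \<Longrightarrow> \<phi> x = 0 \<and> deriv \<phi> x = 0"
    using test_function_bounded_support[OF \<phi>] by metis
  have "integrable lebesgue (\<lambda>x. f x * deriv \<phi> ((x - x0) / \<epsilon>))"
  \<comment> \<open>Outside this interval \<open>(x - x0) / \<epsilon>\<close> has absolute value at
    least R, where the derivative of \<phi> vanishes.\<close>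
  proof (rule integrable_mult_continuous[where K = "{x0 - \<epsilon> * R..x0 + \<epsilon> * R}"])
    show "f absolutely_integrable_on {x0 - \<epsilon> * R..x0 + \<epsilon> * R}"
      using f by (auto simp: locally_integrable_def)
    show "continuous_on {x0 - \<epsilon> * R..x0 + \<epsilon> * R} (\<lambda>x. deriv \<phi> ((x - x0) / \<epsilon>))"
      using \<open>\<epsilon> > 0\<close>
      by (intro continuous_on_compose2[OF test_function_continuous[OF \<phi>', of UNIV]] continuous_intros) auto
    show "deriv \<phi> ((x - x0) / \<epsilon>) = 0" if "x \<notin> {x0 - \<epsilon> * R..x0 + \<epsilon> * R}" for x
    proof -
      have "\<epsilon> * R \<le> \<bar>x - x0\<bar>"
        using that by auto
      then show ?thesis
        using R \<open>\<epsilon> > 0\<close> by (simp add: abs_div pos_le_divide_eq mult.commute)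
    qed
  qed simp
  then have int: "integrable lebesgue (\<lambda>u. f (x0 + \<epsilon> * u) * deriv \<phi> u)"
    using lebesgue_integrable_real_affine_iff[of \<epsilon> "\<lambda>x. f x * deriv \<phi> ((x - x0) / \<epsilon>)" x0] \<open>\<epsilon> > 0\<close>
    by simp
  have int': "integrable lebesgue (\<lambda>u. f x0 * deriv \<phi> u)"
    using integrable_test_function[OF \<phi>'] by simp
  have eq: "(f (x0 + \<epsilon> * u) - f x0) / \<epsilon> * deriv \<phi> u =
     (f (x0 + \<epsilon> * u) * deriv \<phi> u - f x0 * deriv \<phi> u) / \<epsilon>" for u
    by (simp add: algebra_simps)
  show "integrable lebesgue (\<lambda>u. (f (x0 + \<epsilon> * u) - f x0) / \<epsilon> * deriv \<phi> u)"
    unfolding eq using int int' by (intro integrable_divide Bochner_Integration.integrable_diff)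
  have "(LINT u|lebesgue. deriv \<phi> u) = (LINT u:{-R<..<R}|lebesgue. deriv \<phi> u)"
    unfolding set_lebesgue_integral_def
    by (rule Bochner_Integration.integral_cong)
      (use R in \<open>auto simp: indicator_def minus_less_iff simp flip: not_le\<close>)
  also have "\<dots> = 0"
    using set_integral_FTC(2)[OF _ test_function_has_derivative[OF \<phi>] test_function_continuous[OF \<phi>'], of "-R" R]
      R[of R] R[of "-R"] \<open>R > 0\<close> by simp
  finally have "(LINT u|lebesgue. deriv \<phi> u) = 0" .
  then have "(LINT u|lebesgue. (f (x0 + \<epsilon> * u) - f x0) / \<epsilon> * deriv \<phi> u) =
      (LINT u|lebesgue. f (x0 + \<epsilon> * u) * deriv \<phi> u) / \<epsilon>"
    unfolding eq using int int' by simp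
  moreover have "regular_distribution f (deriv (rescaled \<phi> x0 \<epsilon>)) =
      (LINT u|lebesgue. f (x0 + \<epsilon> * u) * deriv \<phi> u) / \<epsilon>"
    using lebesgue_integral_real_affine[of \<epsilon> "\<lambda>x. f x * deriv \<phi> ((x - x0) / \<epsilon>) / \<epsilon>\<^sup>2" x0] \<open>\<epsilon> > 0\<close>
    by (simp add: regular_distribution_def der power2_eq_square)
  ultimately show "distributional_deriv (regular_distribution f) (rescaled \<phi> x0 \<epsilon>) =
       - (LINT u|lebesgue. (f (x0 + \<epsilon> * u) - f x0) / \<epsilon> * deriv \<phi> u)"
    by (simp only: distributional_deriv_def)
qed

lemma distributional_deriv_rescaled_tendsto:
  assumes f: "locally_integrable f"
    and right: "has_right_Borel_derivative f x0 Lp"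
    and left: "has_left_Borel_derivative f x0 Lm"
    and \<phi>: "\<phi> \<in> test_functions"
  shows "((\<lambda>\<epsilon>. distributional_deriv (regular_distribution f) (rescaled \<phi> x0 \<epsilon>)) \<longlongrightarrow>
     Lp * (LINT u:{0<..}|lebesgue. \<phi> u) + Lm * (LINT u:{..<0}|lebesgue. \<phi> u)) (at_right 0)"
proof -
  note \<phi>' = deriv_test_function(1)[OF \<phi>] and \<phi>'' = deriv_test_function(1)[OF deriv_test_function(1)[OF \<phi>]]
  obtain R where "R > 0" and R: "\<And>x. R \<le> \<bar>x\<bar> \<Longrightarrow> \<phi> x = 0 \<and> deriv \<phi> x = 0"
    using test_function_bounded_support[OF \<phi>] by metis
  define g where "g t = (f (x0 + t) - f x0) / t" for t
  define g' where "g' t = (f x0 - f (x0 - t)) / t" for t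
  have "((\<lambda>\<epsilon>. LINT u:{0<..<R}|lebesgue. (u * deriv \<phi> u) * g (\<epsilon> * u)) \<longlongrightarrow>
    - (Lp * (LINT u:{0<..<R}|lebesgue. \<phi> u))) (at_right 0)"
    by (rule tendsto_integral_against_derivative[OF _ _ test_function_has_derivative[OF \<phi>]
          test_function_has_derivative[OF \<phi>'] test_function_continuous[OF \<phi>'']])
      (use right R \<open>R > 0\<close> in \<open>auto simp: has_right_Borel_derivative_def g_def\<close>)
  \<comment> \<open>The left half line is handled by the reflected function \<psi>(u) = \<phi>(-u).
    The sign in \<psi>'(u) = -\<phi>'(-u) matches the reversed difference in
    \<open>g'\<close>.\<close>
  moreover have "((\<lambda>\<epsilon>. LINT u:{0<..<R}|lebesgue. (u * - deriv \<phi> (- u)) * g' (\<epsilon> * u)) \<longlongrightarrow>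
    - (Lm * (LINT u:{0<..<R}|lebesgue. \<phi> (- u)))) (at_right 0)"
  proof (rule tendsto_integral_against_derivative)
    show "((\<lambda>u. \<phi> (- u)) has_real_derivative - deriv \<phi> (- u)) (at u)" for u
      using test_function_has_derivative[OF \<phi>] by (simp flip: DERIV_mirror)
    show "((\<lambda>u. - deriv \<phi> (- u)) has_real_derivative deriv (deriv \<phi>) (- u)) (at u)" for u
      by (rule derivative_eq_intros test_function_has_derivative[OF \<phi>', THEN DERIV_chain2] refl | simp)+
    show "continuous_on UNIV (\<lambda>u. deriv (deriv \<phi>) (- u))"
      by (intro continuous_on_compose2[OF test_function_continuous[OF \<phi>'', of UNIV]] continuous_intros) auto
  qed (use left R \<open>R > 0\<close> in \<open>auto simp: has_left_Borel_derivative_def g'_def\<close>)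
  ultimately have lim: "((\<lambda>\<epsilon>. - ((LINT u:{0<..<R}|lebesgue. (u * deriv \<phi> u) * g (\<epsilon> * u)) +
      (LINT u:{0<..<R}|lebesgue. (u * - deriv \<phi> (- u)) * g' (\<epsilon> * u)))) \<longlongrightarrow>
      - (- (Lp * (LINT u:{0<..<R}|lebesgue. \<phi> u)) + - (Lm * (LINT u:{0<..<R}|lebesgue. \<phi> (- u))))) (at_right 0)"
    by (intro tendsto_intros)
  have eq: "distributional_deriv (regular_distribution f) (rescaled \<phi> x0 \<epsilon>) =
      - ((LINT u:{0<..<R}|lebesgue. (u * deriv \<phi> u) * g (\<epsilon> * u)) +
      (LINT u:{0<..<R}|lebesgue. (u * - deriv \<phi> (- u)) * g' (\<epsilon> * u)))" if "\<epsilon> > 0" for \<epsilon>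
  proof -
    have "(LINT u|lebesgue. (f (x0 + \<epsilon> * u) - f x0) / \<epsilon> * deriv \<phi> u) =
      (LINT u:{0<..<R}|lebesgue. (f (x0 + \<epsilon> * u) - f x0) / \<epsilon> * deriv \<phi> u) +
      (LINT u:{0<..<R}|lebesgue. (f (x0 + \<epsilon> * - u) - f x0) / \<epsilon> * deriv \<phi> (- u))"
      by (rule integral_eq_half_lines(1)[OF distributional_deriv_rescaled(1)[OF f \<phi> that]]) (simp add: R)
    \<comment> \<open>For u > 0 the factor u cancels against the denominator \<epsilon> u of
      \<open>g (\<epsilon> * u)\<close> and \<open>g' (\<epsilon> * u)\<close>, leaving division by
      \<epsilon>.\<close>
    also have "\<dots> = (LINT u:{0<..<R}|lebesgue. (u * deriv \<phi> u) * g (\<epsilon> * u)) +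
      (LINT u:{0<..<R}|lebesgue. (u * - deriv \<phi> (- u)) * g' (\<epsilon> * u))"
      using that by (intro arg_cong2[of _ _ _ _ "(+)"] set_lebesgue_integral_cong)
        (auto simp: g_def g'_def field_simps)
    finally show ?thesis
      by (simp add: distributional_deriv_rescaled(2)[OF f \<phi> that])
  qed
  have "((\<lambda>\<epsilon>. distributional_deriv (regular_distribution f) (rescaled \<phi> x0 \<epsilon>)) \<longlongrightarrow>
      - (- (Lp * (LINT u:{0<..<R}|lebesgue. \<phi> u)) + - (Lm * (LINT u:{0<..<R}|lebesgue. \<phi> (- u))))) (at_right 0)"
    by (rule Lim_transform_eventually[OF lim eventually_mono[OF eventually_at_right_less]]) (simp add: eq)
  then show ?thesis
    using integral_eq_half_lines(2,3)[OF integrable_test_function[OF \<phi>], of R] R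
    by (simp add: add.commute)
qed

lemma integral_eq_sum_half_lines:
  assumes "\<phi> \<in> test_functions"
  shows "(LINT u|lebesgue. \<phi> u) = (LINT u:{0<..}|lebesgue. \<phi> u) + (LINT u:{..<0}|lebesgue. \<phi> u)"
proof -
  obtain R where "\<And>x. R \<le> \<bar>x\<bar> \<Longrightarrow> \<phi> x = 0"
    using test_function_bounded_support[OF assms] by metis
  then show ?thesis
    using integral_eq_half_lines[OF integrable_test_function[OF assms], of R] by simp
qed

lemma integral_supp_half_line:
  "supp \<phi> \<subseteq> {0..} \<Longrightarrow> (LINT u:{..<0}|lebesgue. \<phi> u) = 0"
  "supp \<phi> \<subseteq> {..0} \<Longrightarrow> (LINT u:{0<..}|lebesgue. \<phi> u) = 0"
proof -
  have *: "(LINT u:S|lebesgue. \<phi> u) = 0" if "S \<inter> supp \<phi> = {}" for S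
  proof -
    have "indicator S u *\<^sub>R \<phi> u = 0" for u
      using that zero_outside_supp[of u \<phi>] by (auto simp: indicator_def)
    then show ?thesis
      by (simp only: set_lebesgue_integral_def Bochner_Integration.integral_zero)
  qed
  show "supp \<phi> \<subseteq> {0..} \<Longrightarrow> (LINT u:{..<0}|lebesgue. \<phi> u) = 0"
    "supp \<phi> \<subseteq> {..0} \<Longrightarrow> (LINT u:{0<..}|lebesgue. \<phi> u) = 0"
    by (rule *; force)+
qed

section \<open>Construction of bump functions\<close>

text \<open>For p = 1 this is the classical smooth function exp(-1/x), flat at 0. The polynomial in
  1/x makes the family closed under differentiation.\<close>

definition flat_exp :: "real poly \<Rightarrow> real \<Rightarrow> real" where
  "flat_exp p x = (if x > 0 then poly p (1 / x) * exp (- 1 / x) else 0)"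

lemma tendsto_poly_mult_exp_minus: "((\<lambda>y. poly p y * exp (- y)) \<longlongrightarrow> 0) (at_top :: real filter)"
proof -
  have "((\<lambda>y. \<Sum>i\<le>degree p. coeff p i * (y ^ i / exp y)) \<longlongrightarrow> (\<Sum>i\<le>degree p. coeff p i * 0)) at_top"
    by (intro tendsto_intros tendsto_power_div_exp_0)
  then show ?thesis
    by (simp add: poly_altdef sum_distrib_right exp_minus divide_inverse mult.assoc)
qed

text \<open>With y = 1/x one has d/dx = -y^2 d/dy, so p(y) exp(-y) becomes y^2 (p - p')(y) exp(-y);
  the polynomial \<open>[:0, 0, 1:]\<close> is y^2. At 0 the exponential decay beats every
  polynomial.\<close>

lemma flat_exp_has_real_derivative:
  "(flat_exp p has_real_derivative flat_exp ([:0, 0, 1:] * (p - pderiv p)) x) (at x)"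
proof (cases x "0::real" rule: linorder_cases)
  case less
  have "((\<lambda>_. 0) has_real_derivative 0) (at x)"
    by simp
  then have "(flat_exp p has_real_derivative 0) (at x)"
    by (rule has_field_derivative_transform_within_open[of _ _ _ "{..<0}"])
      (use less in \<open>auto simp: flat_exp_def\<close>)
  then show ?thesis
    using less by (simp add: flat_exp_def)
next
  case greater
  have "((\<lambda>x. poly p (1 / x) * exp (- 1 / x)) has_real_derivative
      flat_exp ([:0, 0, 1:] * (p - pderiv p)) x) (at x)"
    unfolding flat_exp_def
    by (rule derivative_eq_intros poly_DERIV[THEN DERIV_chain2] refl | use greater in \<open>simp add: field_simps\<close>)+
  then show ?thesis
    by (rule has_field_derivative_transform_within_open[of _ _ _ "{0<..}"])
      (use greater in \<open>auto simp: flat_exp_def\<close>)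
next
  case equal
  \<comment> \<open>\<open>pCons 0 p\<close> is y p(y): the additional factor y = 1/x comes from the
    difference quotient at 0.\<close>
  have "((\<lambda>y. poly (pCons 0 p) y * exp (- y)) \<longlongrightarrow> 0) at_top"
    by (rule tendsto_poly_mult_exp_minus)
  then have "((\<lambda>x. poly (pCons 0 p) (1 / x) * exp (- (1 / x))) \<longlongrightarrow> 0) (at_right 0)"
    by (rule filterlim_compose) (use filterlim_inverse_at_top_right in \<open>simp add: inverse_eq_divide\<close>)
  then have "((\<lambda>x. flat_exp p x / x) \<longlongrightarrow> 0) (at_right 0)"
    by (rule Lim_transform_eventually)
      (auto simp: eventually_at_right_field flat_exp_def intro: exI[of _ 1])
  moreover have "((\<lambda>x. flat_exp p x / x) \<longlongrightarrow> 0) (at_left 0)"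
    by (rule Lim_transform_eventually[OF tendsto_const])
      (auto simp: eventually_at_left_field flat_exp_def intro: exI[of _ "-1"])
  ultimately have "((\<lambda>x. flat_exp p x / x) \<longlongrightarrow> 0) (at 0)"
    by (simp add: filterlim_split_at_real)
  then show ?thesis
    using equal by (simp add: has_field_derivative_iff flat_exp_def)
qed

text \<open>Closed under differentiation, hence consisting of smooth functions.\<close>

inductive bump_span :: "real \<Rightarrow> real \<Rightarrow> (real \<Rightarrow> real) \<Rightarrow> bool" for a b where
  prod: "bump_span a b (\<lambda>x. flat_exp p (x - a) * flat_exp q (b - x))"
| add: "bump_span a b F \<Longrightarrow> bump_span a b G \<Longrightarrow> bump_span a b (\<lambda>x. F x + G x)"

lemma bump_span_derivative:
  "bump_span a b F \<Longrightarrow> \<exists>G. bump_span a b G \<and> (\<forall>x. (F has_real_derivative G x) (at x))"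
proof (induction rule: bump_span.induct)
  case (prod p q)
  let ?d = "\<lambda>p. [:0, 0, 1:] * (p - pderiv p) :: real poly"
  \<comment> \<open>The chain rule factor -1 of b - x is absorbed into the polynomial, since the
    span is generated by products and sums alone.\<close>
  have minus: "flat_exp (- p) x = - flat_exp p x" for p x
    by (simp add: flat_exp_def)
  have "((\<lambda>x. flat_exp p (x - a) * flat_exp q (b - x)) has_real_derivative
      flat_exp (?d p) (x - a) * flat_exp q (b - x) + flat_exp p (x - a) * flat_exp (- ?d q) (b - x)) (at x)" for x
    unfolding minus
    by (rule derivative_eq_intros flat_exp_has_real_derivative[THEN DERIV_chain2] refl | simp)+
  with bump_span.add[OF bump_span.prod[of a b "?d p" q] bump_span.prod[of a b p "- ?d q"]]
  show ?case by blast
next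
  case (add F G)
  then obtain F' G' where "bump_span a b F'" "\<And>x. (F has_real_derivative F' x) (at x)"
    "bump_span a b G'" "\<And>x. (G has_real_derivative G' x) (at x)" by blast
  then show ?case
    by (intro exI[of _ "\<lambda>x. F' x + G' x"]) (auto intro: bump_span.add DERIV_add)
qed

lemma bump_span_smooth:
  assumes "bump_span a b F"
  shows "smooth F"
proof -
  \<comment> \<open>All iterated derivatives stay in the span, and every member of the span is
    differentiable.\<close>
  have "bump_span a b ((deriv ^^ k) F)" for k
  proof (induction k)
    case (Suc k)
    then obtain G where "bump_span a b G" "\<And>x. ((deriv ^^ k) F has_real_derivative G x) (at x)"
      using bump_span_derivative by blast
    moreover from this(2) have "deriv ((deriv ^^ k) F) = G"
      by (auto intro: DERIV_imp_deriv)
    ultimately show ?case by simp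
  qed (use assms in simp)
  then show ?thesis
    unfolding smooth_def using bump_span_derivative
    by (metis differentiable_at_imp_differentiable_on real_differentiable_def)
qed

text \<open>Supplies test functions on one side of 0 whose integral can be divided out. The product
  of the two flat factors is positive exactly on (a, b).\<close>

lemma exists_bump_function:
  fixes a b :: real
  assumes "a < b"
  shows "\<exists>\<phi>\<in>test_functions. supp \<phi> \<subseteq> {a..b} \<and> (LINT x|lebesgue. \<phi> x) > 0"
proof -
  define \<phi> where "\<phi> x = flat_exp 1 (x - a) * flat_exp 1 (b - x)" for x
  have span: "bump_span a b \<phi>"
    unfolding \<phi>_def by (rule bump_span.prod)
  have supp: "supp \<phi> \<subseteq> {a..b}"
    unfolding supp_def by (rule closure_minimal) (auto simp: support_on_def \<phi>_def flat_exp_def split: if_splits)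
  have "compact (supp \<phi>)"
    using supp unfolding supp_def by (metis bounded_closed_interval bounded_subset closed_closure compact_eq_bounded_closed)
  with span have "\<phi> \<in> test_functions"
    by (simp add: test_functions_def bump_span_smooth)
  have cont: "continuous_on UNIV \<phi>"
    using bump_span_derivative[OF span] DERIV_continuous_on by blast
  have pos: "\<phi> x > 0" if "a < x" "x < b" for x
    using that by (simp add: \<phi>_def flat_exp_def)
  have nonneg: "\<phi> x \<ge> 0" for x
    by (simp add: \<phi>_def flat_exp_def)
  have zero: "\<phi> x = 0" if "x \<notin> {a..b}" for x
    using that by (auto simp: \<phi>_def flat_exp_def)
  have eq: "indicator {a..b} x *\<^sub>R \<phi> x = \<phi> x" for x
    using zero[of x] by (auto simp: indicator_def)
  have int: "integrable lebesgue \<phi>"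
    using absolutely_integrable_continuous_real[OF continuous_on_subset[OF cont], of a b]
    by (simp add: set_integrable_def eq[unfolded real_scaleR_def])
  \<comment> \<open>A nonnegative function with integral 0 vanishes almost everywhere, which would
    make (a, b) a null set.\<close>
  have "(LINT x|lebesgue. \<phi> x) \<noteq> 0"
  proof
    assume "(LINT x|lebesgue. \<phi> x) = 0"
    then have "AE x in lebesgue. \<phi> x = 0"
      using integral_nonneg_eq_0_iff_AE[OF int] nonneg by simp
    then have "AE x in lebesgue. x \<notin> {a<..<b}"
      by eventually_elim (use pos in force)
    then have "{a<..<b} \<in> null_sets lebesgue"
      by (subst AE_iff_null_sets) auto
    then show False
      using \<open>a < b\<close> by (auto dest: null_setsD1)
  qed
  moreover have "(LINT x|lebesgue. \<phi> x) \<ge> 0"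
    using nonneg by simp
  ultimately show ?thesis
    using \<open>\<phi> \<in> test_functions\<close> supp by (intro bexI[of _ \<phi>]) auto
qed

section \<open>One-sided and two-sided point values of the derivative\<close>

theorem theorem3p11:
  fixes f :: "real \<Rightarrow> real" and x0 Lp Lm :: real
  defines "T' \<equiv> distributional_deriv (regular_distribution f)"
  assumes "locally_integrable f"
    and "has_right_Borel_derivative f x0 Lp"
    and "has_left_Borel_derivative f x0 Lm"
  shows "(\<forall>\<phi>\<in>test_functions.
            ((\<lambda>\<epsilon>. T' (rescaled \<phi> x0 \<epsilon>)) \<longlongrightarrow>
               Lp * (LINT u:{0<..}|lebesgue. \<phi> u) + Lm * (LINT u:{..<0}|lebesgue. \<phi> u)) (at_right 0))
         \<and> has_right_point_value T' x0 Lp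
         \<and> has_left_point_value T' x0 Lm
         \<and> ((\<exists>L. has_point_value T' x0 L) \<longleftrightarrow> Lp = Lm)
         \<and> (Lp = Lm \<longrightarrow> (\<forall>L. has_point_value T' x0 L \<longleftrightarrow> L = Lp))"
proof -
  note lim = distributional_deriv_rescaled_tendsto[OF assms(2-4), folded T'_def]
  have dist: "distribution T'"
    unfolding T'_def using assms(2) by (rule distribution_distributional_deriv_regular)
  have right: "has_right_point_value T' x0 Lp"
    unfolding has_right_point_value_def
  proof (intro conjI ballI impI dist)
    fix \<phi> assume "\<phi> \<in> test_functions" "supp \<phi> \<subseteq> {0..}"
    then show "((\<lambda>\<epsilon>. T' (rescaled \<phi> x0 \<epsilon>)) \<longlongrightarrow> Lp * (LINT u|lebesgue. \<phi> u)) (at_right 0)"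
      using lim[of \<phi>] integral_supp_half_line(1)[of \<phi>] integral_eq_sum_half_lines[of \<phi>] by simp
  qed
  have left: "has_left_point_value T' x0 Lm"
    unfolding has_left_point_value_def
  proof (intro conjI ballI impI dist)
    fix \<phi> assume "\<phi> \<in> test_functions" "supp \<phi> \<subseteq> {..0}"
    then show "((\<lambda>\<epsilon>. T' (rescaled \<phi> x0 \<epsilon>)) \<longlongrightarrow> Lm * (LINT u|lebesgue. \<phi> u)) (at_right 0)"
      using lim[of \<phi>] integral_supp_half_line(2)[of \<phi>] integral_eq_sum_half_lines[of \<phi>] by simp
  qed
  \<comment> \<open>A bump supported on one side of 0 tests L against the corresponding one-sided
    value, by uniqueness of limits. This gives Lp = Lm whenever a point value exists, and also that
    the point value is unique.\<close>
  have unique: "L = Lp \<and> L = Lm" if L: "has_point_value T' x0 L" for L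
  proof
    obtain \<phi> where \<phi>: "\<phi> \<in> test_functions" "supp \<phi> \<subseteq> {0..}" "(LINT x|lebesgue. \<phi> x) > 0"
      using exists_bump_function[of 0 1] Icc_subset_Ici_iff[of 0 1 "0::real"] by fastforce
    then have "L * (LINT x|lebesgue. \<phi> x) = Lp * (LINT x|lebesgue. \<phi> x)"
      using L right unfolding has_point_value_def has_right_point_value_def
      by (intro tendsto_unique[of "at_right 0" "\<lambda>\<epsilon>. T' (rescaled \<phi> x0 \<epsilon>)"]) auto
    then show "L = Lp"
      using \<phi>(3) by simp
    obtain \<psi> where \<psi>: "\<psi> \<in> test_functions" "supp \<psi> \<subseteq> {..0}" "(LINT x|lebesgue. \<psi> x) > 0"
      using exists_bump_function[of "-1" 0] Icc_subset_Iic_iff[of "-1" 0 "0::real"] by fastforce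
    then have "L * (LINT x|lebesgue. \<psi> x) = Lm * (LINT x|lebesgue. \<psi> x)"
      using L left unfolding has_point_value_def has_left_point_value_def
      by (intro tendsto_unique[of "at_right 0" "\<lambda>\<epsilon>. T' (rescaled \<psi> x0 \<epsilon>)"]) auto
    then show "L = Lm"
      using \<psi>(3) by simp
  qed
  \<comment> \<open>For equal one-sided values the two half line integrals add up to the integral of
    \<phi> over the whole line.\<close>
  have "has_point_value T' x0 Lp" if "Lp = Lm"
    unfolding has_point_value_def
    using dist lim that integral_eq_sum_half_lines by (simp flip: distrib_left)
  with lim right left unique show ?thesis
    by blast
qed

end
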